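(* Let $\{x_k\}$ be generated by the three-step algorithm $x_{k+1/3}=\mathcal O_{f_0}(\lambda_k,x_k)$, $x_{k+2/3}=\mathcal O_{f_1}(\mu_k,x_{k+1/3})$, $x_{k+1}=\mathcal P_{X_0}(x_{k+2/3})$, $k=0,1,2,\dots$, from a starting point $x_0\in\mathbb R^n$. Assume that: (i) $X_1\neq\emptyset$, and $X_1$ is bounded (or $\{x_k\}$ is bounded); (ii) $\sum_{k=0}^\infty\lambda_k=\infty$, $\mu_k\to0$ and $\mu_k/\lambda_k\to0$; (iii) $\mathcal O_{f_0}$ and $\mathcal O_{f_1}$ satisfy Property 1 (with error terms $\rho_0$, $\rho_1$), and $\mathcal O_{f_1}$ also satisfies Property 2 (both properties are given in the context); (iv) there is $\underline f>-\infty$ such that $f_1(x_{k+2/3})\ge\underline f$ for all $k$; (v) $\|x_k-x_{k+1/3}\|\to0$; (vi) $\rho_0(\lambda_k,k)\to0$, and there is $\overline\rho_1<\infty$ with $\rho_1(\mu_k,k)\le\overline\rho_1$ for all $k$; (vii) there exists $M$ such that for every $k\in\mathbb N$ there is $v_k\in\partial f_0(x_k)$ with $\|v_k\|<M$. Then $$\lim_{k\to\infty}d_{X_1}(x_k)=0.$$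
   Context: $f_0,f_1:\mathbb R^n\to\mathbb R$ are convex functions, $X_0\subset\mathbb R^n$ is a nonempty closed convex set, $\|\cdot\|$ is the Euclidean norm, $\partial f$ is the convex subdifferential. $\{\lambda_k\}$ and $\{\mu_k\}$ are nonnegative stepsize sequences ($\lambda_k>0$ so that the quotients make sense). For a nonempty closed convex set $X$, $\mathcal P_X(x)=\operatorname{argmin}_{y\in X}\|x-y\|$ and $d_X(x)=\|x-\mathcal P_X(x)\|$. $f_0^*$ is the optimal value of $f_0$ over $X_0$ and $X_1=\{x\in X_0: f_0(x)=f_0^*\}$. The operators $\mathcal O_{f_i}:[0,\infty)\times\mathbb R^n\to\mathbb R^n$, $i\in\{0,1\}$, come with real-valued error terms $\rho_i(\lambda,k)$, $\lambda\ge0$, $k\in\mathbb N$. Property 1: there is $\beta>0$ such that for any $\lambda\ge0$, all $k\in\mathbb N$, and all $x,y\in\mathbb R^n$ (with $x$ in the role of $x_{k+i/3}$), $$\|\mathcal O_{f_i}(\lambda,x)-y\|^2\le\|x-y\|^2-\beta\lambda\bigl(f_i(\mathcal O_{f_i}(\lambda,x))-f_i(y)\bigr)+\lambda\rho_i(\lambda,k).$$ The same $\beta$ is used for $i=0$ and $i=1$. Property 2: there exists $\gamma>0$ such that $\|x-\mathcal O_{f_i}(\lambda,x)\|\le\lambda\gamma$ for all $\lambda\ge0$ and $x\in\mathbb R^n$. *)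

theory Defs
  imports "HOL-Analysis.Analysis"
begin

definition subdifferential :: "('a::real_inner \<Rightarrow> real) \<Rightarrow> 'a \<Rightarrow> 'a set" where
  "subdifferential f x = {v. \<forall>y. f y \<ge> f x + inner v (y - x)}"

text \<open>The optimal value is taken in the extended reals, since \<^const>\<open>Inf\<close> on the reals is
  unspecified for sets that are not bounded below.\<close>

definition optimal_value :: "('a \<Rightarrow> real) \<Rightarrow> 'a set \<Rightarrow> ereal" where
  "optimal_value f X = (INF x\<in>X. ereal (f x))"

definition optimal_set :: "('a \<Rightarrow> real) \<Rightarrow> 'a set \<Rightarrow> 'a set" where
  "optimal_set f X = {x \<in> X. ereal (f x) = optimal_value f X}"

text \<open>Meaningful for nonempty closed convex \<open>X\<close>, where \<^const>\<open>closest_point\<close> is the metric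
  projection.\<close>

definition proj_dist :: "'a::euclidean_space set \<Rightarrow> 'a \<Rightarrow> real" where
  "proj_dist X x = norm (x - closest_point X x)"

text \<open>Operators are total functions of the stepsize, but are constrained only for
  nonnegative stepsizes. The constant \<open>\<beta>\<close> is a parameter because it has to be
  shared by several operators.\<close>

definition property1 ::
  "real \<Rightarrow> ('a::real_normed_vector \<Rightarrow> real) \<Rightarrow> (real \<Rightarrow> 'a \<Rightarrow> 'a) \<Rightarrow> (real \<Rightarrow> nat \<Rightarrow> real) \<Rightarrow> bool" where
  "property1 \<beta> f Op \<rho> \<longleftrightarrow>
    (\<forall>l\<ge>0. \<forall>k x y.
      (norm (Op l x - y))\<^sup>2 \<le> (norm (x - y))\<^sup>2 - \<beta> * l * (f (Op l x) - f y) + l * \<rho> l k)"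

definition property2 :: "(real \<Rightarrow> 'a::real_normed_vector \<Rightarrow> 'a) \<Rightarrow> bool" where
  "property2 Op \<longleftrightarrow> (\<exists>\<gamma>>0. \<forall>l\<ge>0. \<forall>x. norm (x - Op l x) \<le> l * \<gamma>)"

end

theory Submission
  imports Defs
begin

text \<open>The squared distance \<open>d\<^sub>k\<^sup>2\<close> from the \<open>k\<close>-th iterate to \<open>X1\<close> is a Lyapunov function as long
  as \<open>d\<^sub>k\<close> is not small. Chaining Property 1 for both operators with the nonexpansiveness of the
  projection onto \<open>X0\<close>, all compared with the point \<open>p\<^sub>k\<close> of \<open>X1\<close> nearest to the iterate, gives
  \<open>d\<^bsub>k+1\<^esub>\<^sup>2 \<le> d\<^sub>k\<^sup>2 - \<beta> * lam k * (f0 (x k) - m - \<delta> k)\<close>, where \<open>m\<close> is the minimum of \<open>f0\<close> over \<open>X0\<close> and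
  \<open>\<delta> k\<close> tends to zero.
  Here the bounded subgradients move the evaluation of \<open>f0\<close> from \<open>x13 k\<close> back to \<open>x k\<close>, and the
  contribution of the \<open>f1\<close> step vanishes relative to \<open>lam k\<close>, because \<open>f1\<close> is bounded below along
  \<open>x23\<close> and bounded above on the bounded sequence \<open>p\<^sub>k\<close>.

  Convexity and compactness bound \<open>f0 - m\<close> below by a positive constant on the iterates in \<open>X0\<close> with
  \<open>d\<^sub>k \<ge> \<eta>\<close> (lemma \<open>convex_sublevel_gap\<close>). Since the stepsizes \<open>lam\<close> have infinite sum, such
  iterates cannot persist: \<open>d\<^sub>k\<close> must drop below \<open>\<eta>\<close>. It never recovers substantially, since the
  increments \<open>x (Suc k) - x k\<close> tend to zero and an iterate outside the \<open>\<eta>\<close>-neighbourhood of \<open>X1\<close>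
  eventually only gets closer to \<open>X1\<close> (lemma \<open>tendsto_0_if_decrease_away_from_0\<close>).

  Both alternatives in the boundedness hypothesis serve to bound the sequence \<open>p\<^sub>k\<close>: it lies in
  \<open>X1\<close>, and its distance to \<open>x k\<close> is at most that of any chosen point of \<open>X1\<close>.\<close>

text \<open>The hypothesis \<open>decr\<close> makes \<open>d\<close> visit every interval \<open>[0, \<eta>)\<close>, or \<open>d\<^sup>2\<close> would tend to minus
  infinity. After such a visit, \<open>d\<close> can exceed \<open>\<eta>\<close> only by one small increment before it has to
  decrease again.\<close>

lemma tendsto_0_if_decrease_away_from_0:
  fixes d s l :: "nat \<Rightarrow> real"
  assumes d: "\<And>k. 0 \<le> d k"
    and l: "\<And>k. 0 \<le> l k" "filterlim (\<lambda>n. \<Sum>k<n. l k) at_top sequentially"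
    and incr: "eventually (\<lambda>k. d (Suc k) \<le> d k + s k) sequentially" "s \<longlonglongrightarrow> 0"
    and decr: "\<And>\<eta>. \<eta> > 0 \<Longrightarrow> \<exists>c>0. eventually (\<lambda>k. \<eta> \<le> d k \<longrightarrow> (d (Suc k))\<^sup>2 \<le> (d k)\<^sup>2 - c * l k) sequentially"
  shows "d \<longlonglongrightarrow> 0"
proof (rule LIMSEQ_I)
  fix \<epsilon> :: real assume "\<epsilon> > 0"
  define \<eta> where "\<eta> = \<epsilon> / 2"
  have \<eta>: "\<eta> > 0" using \<open>\<epsilon> > 0\<close> by (simp add: \<eta>_def)
  obtain c where c: "c > 0"
    and ev: "eventually (\<lambda>k. \<eta> \<le> d k \<longrightarrow> (d (Suc k))\<^sup>2 \<le> (d k)\<^sup>2 - c * l k) sequentially"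
    using decr[OF \<eta>] by blast
  have "eventually (\<lambda>k. s k < \<eta>) sequentially"
    using order_tendstoD(2)[OF incr(2) \<eta>] .
  with ev incr(1) have "eventually (\<lambda>k. (\<eta> \<le> d k \<longrightarrow> (d (Suc k))\<^sup>2 \<le> (d k)\<^sup>2 - c * l k)
      \<and> d (Suc k) \<le> d k + s k \<and> s k < \<eta>) sequentially"
    by eventually_elim auto
  then obtain N where N: "\<And>k. k \<ge> N \<Longrightarrow> \<eta> \<le> d k \<Longrightarrow> (d (Suc k))\<^sup>2 \<le> (d k)\<^sup>2 - c * l k"
    "\<And>k. k \<ge> N \<Longrightarrow> d (Suc k) \<le> d k + s k" "\<And>k. k \<ge> N \<Longrightarrow> s k < \<eta>"
    unfolding eventually_sequentially by blast
  have "\<exists>m\<ge>N. d m < \<eta>"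
  proof (rule ccontr)
    assume "\<not> ?thesis"
    then have far: "\<eta> \<le> d m" if "m \<ge> N" for m using that by (auto simp: not_less)
    have bound: "(d n)\<^sup>2 \<le> (d N)\<^sup>2 - c * ((\<Sum>k<n. l k) - (\<Sum>k<N. l k))" if "n \<ge> N" for n
      using that
    proof (induction n rule: dec_induct)
      case base then show ?case by simp
    next
      case (step n)
      then show ?case using N(1)[of n] far[of n] by (simp add: algebra_simps)
    qed
    have "eventually (\<lambda>n. (\<Sum>k<n. l k) > (\<Sum>k<N. l k) + (d N)\<^sup>2 / c) sequentially"
      using l(2) by (simp add: filterlim_at_top_dense)
    then have "eventually (\<lambda>n. (\<Sum>k<n. l k) > (\<Sum>k<N. l k) + (d N)\<^sup>2 / c \<and> n \<ge> N) sequentially"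
      using eventually_ge_at_top by (rule eventually_conj)
    then obtain n where n: "(\<Sum>k<n. l k) > (\<Sum>k<N. l k) + (d N)\<^sup>2 / c" "n \<ge> N"
      unfolding eventually_sequentially by blast
    have "c * ((\<Sum>k<n. l k) - (\<Sum>k<N. l k)) > (d N)\<^sup>2"
      using n(1) c by (simp add: field_simps)
    with bound[OF n(2)] show False using zero_le_power2[of "d n"] by linarith
  qed
  then obtain m where m: "m \<ge> N" "d m < \<eta>" by blast
  have "d n < \<epsilon>" if "n \<ge> m" for n
    using that
  proof (induction n rule: dec_induct)
    case base then show ?case using m \<eta> by (simp add: \<eta>_def)
  next
    case (step n)
    have "n \<ge> N" using step m by simp
    show ?case
    proof (cases "d n < \<eta>")
      case True
      then show ?thesis using N(2,3)[OF \<open>n \<ge> N\<close>] by (simp add: \<eta>_def)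
    next
      case False
      then have "(d (Suc n))\<^sup>2 \<le> (d n)\<^sup>2 - c * l n" using N(1)[OF \<open>n \<ge> N\<close>] by simp
      also have "\<dots> \<le> (d n)\<^sup>2" using c l(1)[of n] by simp
      finally have "d (Suc n) \<le> d n" using d by (rule power2_le_imp_le)
      then show ?thesis using step by simp
    qed
  qed
  then show "\<exists>no. \<forall>n\<ge>no. norm (d n - 0) < \<epsilon>" using d by auto
qed

text \<open>A convex function grows at least linearly along the segment from a nearest point \<open>p\<close> of the
  sublevel set to \<open>x\<close>, so its value at \<open>x\<close> is controlled by its value where this segment leaves
  the \<open>\<eta>\<close>-neighbourhood. Bounding \<open>p\<close> instead of \<open>x\<close> keeps these exit points in a compact set even
  if \<open>x\<close> ranges over an unbounded one.\<close>

lemma convex_sublevel_gap: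
  fixes f :: "'a::euclidean_space \<Rightarrow> real"
  assumes f: "convex_on X f" "continuous_on X f" and X: "closed X" "convex X"
    and S: "S = {x \<in> X. f x \<le> m}" and \<eta>: "\<eta> > 0"
  shows "\<exists>c>0. \<forall>x\<in>X. \<forall>p\<in>S. norm p \<le> B \<longrightarrow> dist x p = infdist x S \<longrightarrow> \<eta> \<le> infdist x S
    \<longrightarrow> m + c \<le> f x"
proof -
  define K where "K = X \<inter> {z. infdist z S = \<eta>} \<inter> cball 0 (B + \<eta>)"
  have "closed {z. infdist z S = \<eta>}"
    by (intro closed_Collect_eq continuous_intros)
  then have K: "compact K"
    unfolding K_def using X(1) by (intro closed_Int_compact closed_Int) auto
  have f_K: "m < f z" if "z \<in> K" for z
  proof (rule ccontr)
    assume "\<not> m < f z"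
    then have "z \<in> S" using that by (simp add: K_def S)
    then show False using that \<eta> by (simp add: K_def)
  qed
  have "\<exists>c>0. \<forall>z\<in>K. m + c \<le> f z"
  proof (cases "K = {}")
    case True
    then show ?thesis by (intro exI[of _ 1]) simp
  next
    case False
    have "continuous_on K f" using f(2) by (rule continuous_on_subset) (auto simp: K_def)
    then obtain z where "z \<in> K" "\<forall>y\<in>K. f z \<le> f y"
      using continuous_attains_inf[OF K False] by blast
    then show ?thesis using f_K by (intro exI[of _ "f z - m"]) auto
  qed
  then obtain c where c: "c > 0" "\<And>z. z \<in> K \<Longrightarrow> m + c \<le> f z" by blast
  have "m + c \<le> f x"
    if x: "x \<in> X" and p: "p \<in> S" "norm p \<le> B" and d: "dist x p = infdist x S" "\<eta> \<le> infdist x S" for x p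
  proof -
    define t where "t = \<eta> / dist x p"
    have t: "0 < t" "t \<le> 1" "t * dist x p = \<eta>" using \<eta> d by (auto simp: t_def)
    define z where "z = (1 - t) *\<^sub>R p + t *\<^sub>R x"
    have pX: "p \<in> X" "f p \<le> m" using p(1) by (auto simp: S)
    have "z - p = t *\<^sub>R (x - p)" "x - z = (1 - t) *\<^sub>R (x - p)" by (simp_all add: z_def algebra_simps)
    then have zp: "dist z p = \<eta>" "dist x z = dist x p - \<eta>"
      using t by (simp_all add: dist_norm left_diff_distrib)
    have "infdist z S = \<eta>"
    proof (rule antisym)
      show "infdist z S \<le> \<eta>" using infdist_le[OF p(1), of z] zp by simp
      show "\<eta> \<le> infdist z S" using infdist_triangle[of x S z] zp d by simp
    qed
    moreover have "z \<in> X" using X(2) x pX t by (simp add: z_def convexD)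
    moreover have "norm z \<le> B + \<eta>"
      using norm_triangle_sub[of z p] zp p(2) by (simp add: dist_norm)
    ultimately have "m + c \<le> f z" by (intro c(2)) (simp add: K_def)
    also have "f z \<le> (1 - t) * f p + t * f x"
      unfolding z_def using t x pX by (intro convex_onD[OF f(1)]) auto
    also have "\<dots> \<le> (1 - t) * m + t * f x"
      using t pX by (intro add_right_mono mult_left_mono) auto
    finally have "c \<le> t * (f x - m)" by (simp add: algebra_simps)
    \<comment> \<open>The product is positive, so \<open>f x - m\<close> is, and dropping the factor \<open>t \<le> 1\<close> increases it.\<close>
    moreover from this have "0 < f x - m" using c(1) t by (smt (verit) mult_nonneg_nonpos)
    then have "t * (f x - m) \<le> f x - m" using t by (intro mult_left_le_one_le) auto
    ultimately show ?thesis by linarith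
  qed
  then show ?thesis using c(1) by blast
qed

lemma optimal_set_eq_sublevel:
  assumes "z \<in> optimal_set f X"
  shows "optimal_set f X = {x \<in> X. f x \<le> f z}"
proof -
  have m: "optimal_value f X = ereal (f z)" using assms by (simp add: optimal_set_def)
  have "f z \<le> f x" if "x \<in> X" for x
    using that INF_lower[of x X "\<lambda>x. ereal (f x)"] by (simp add: m[unfolded optimal_value_def])
  then show ?thesis unfolding optimal_set_def m by force
qed

lemma proj_dist_eq_infdist:
  assumes "closed S" "S \<noteq> {}"
  shows "proj_dist S x = infdist x S"
  using setdist_closest_point[OF assms, of x]
  by (simp add: proj_dist_def infdist_eq_setdist dist_norm)

theorem proposition2:
  fixes f0 f1 :: "real ^ 'n \<Rightarrow> real"
    and X0 X1 :: "(real ^ 'n) set"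
    and O0 O1 :: "real \<Rightarrow> real ^ 'n \<Rightarrow> real ^ 'n"
    and \<rho>0 \<rho>1 :: "real \<Rightarrow> nat \<Rightarrow> real"
    and lam mu :: "nat \<Rightarrow> real"
    and x x13 x23 :: "nat \<Rightarrow> real ^ 'n"
  assumes convex_f: "convex_on UNIV f0" "convex_on UNIV f1"
    and X0: "X0 \<noteq> {}" "closed X0" "convex X0"
    and X1_def: "X1 = optimal_set f0 X0"
    and stepsizes: "\<And>k. lam k > 0" "\<And>k. mu k \<ge> 0"
    and step1: "\<And>k. x13 k = O0 (lam k) (x k)"
    and step2: "\<And>k. x23 k = O1 (mu k) (x13 k)"
    and step3: "\<And>k. x (Suc k) = closest_point X0 (x23 k)"
    and i: "X1 \<noteq> {}" "bounded X1 \<or> bounded (range x)"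
    and ii: "filterlim (\<lambda>n. \<Sum>k<n. lam k) at_top sequentially"
      "mu \<longlonglongrightarrow> 0" "(\<lambda>k. mu k / lam k) \<longlonglongrightarrow> 0"
    and iii: "\<exists>\<beta>>0. property1 \<beta> f0 O0 \<rho>0 \<and> property1 \<beta> f1 O1 \<rho>1" "property2 O1"
    and iv: "\<exists>fl. \<forall>k. f1 (x23 k) \<ge> fl"
    and v: "(\<lambda>k. norm (x k - x13 k)) \<longlonglongrightarrow> 0"
    and vi: "(\<lambda>k. \<rho>0 (lam k) k) \<longlonglongrightarrow> 0" "\<exists>r. \<forall>k. \<rho>1 (mu k) k \<le> r"
    and vii: "\<exists>M. \<forall>k. \<exists>v\<in>subdifferential f0 (x k). norm v < M"
  shows "(\<lambda>k. proj_dist X1 (x k)) \<longlonglongrightarrow> 0"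
proof -
  obtain z where z: "z \<in> X1" using i(1) by blast
  define m where "m = f0 z"
  have X1_sub: "X1 = {x \<in> X0. f0 x \<le> m}"
    using optimal_set_eq_sublevel z by (simp add: X1_def m_def)
  have cont: "continuous_on UNIV f0" "continuous_on UNIV f1"
    using convex_f by (auto intro: convex_on_continuous)
  have "closed X1"
    unfolding X1_sub using X0(2) cont(1)
    by (intro closed_Collect_conj closed_Collect_le continuous_intros) auto
  note cl = \<open>closed X1\<close> i(1)
  define p where "p k = closest_point X1 (x k)" for k
  define d where "d k = infdist (x k) X1" for k
  have p: "p k \<in> X1" "dist (x k) (p k) = d k" for k
    using closest_point_in_set[OF cl] setdist_closest_point[OF cl, of "x k"]
    by (simp_all add: p_def d_def infdist_eq_setdist)
  have pX0: "p k \<in> X0" "f0 (p k) \<le> m" for k using p(1)[of k] by (auto simp: X1_sub)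
  have xX0: "x (Suc k) \<in> X0" for k using closest_point_in_set[OF X0(2,1)] step3 by simp

  have "\<exists>B. \<forall>k. norm (p k) \<le> B"
    using i(2)
  proof
    assume "bounded X1"
    then show ?thesis using p(1) by (meson bounded_iff)
  next
    assume "bounded (range x)"
    then obtain C where C: "norm (x k) \<le> C" for k by (auto simp: bounded_iff)
    have "norm (p k) \<le> C + (C + norm z)" for k
    proof -
      have "dist (x k) (p k) \<le> norm (x k - z)"
        using infdist_le[OF z, of "x k"] p(2)[of k] by (simp add: d_def dist_norm)
      then have "norm (x k - p k) \<le> norm (x k) + norm z"
        using norm_triangle_ineq4[of "x k" z] by (simp add: dist_norm)
      then show ?thesis
        using C[of k] norm_triangle_sub[of "p k" "x k"] by (simp add: norm_minus_commute)
    qed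
    then show ?thesis by blast
  qed
  then obtain B where B: "norm (p k) \<le> B" for k by blast
  have "bounded (f1 ` cball 0 B)"
    using cont(2) continuous_on_subset by (blast intro: compact_imp_bounded compact_continuous_image compact_cball)
  then obtain F where F: "f1 (p k) \<le> F" for k
    using B unfolding bounded_iff by (force simp: abs_le_iff)

  obtain \<beta> where \<beta>: "\<beta> > 0" and P1: "property1 \<beta> f0 O0 \<rho>0" "property1 \<beta> f1 O1 \<rho>1"
    using iii(1) by blast
  obtain \<gamma> where \<gamma>: "\<And>l x. l \<ge> 0 \<Longrightarrow> norm (x - O1 l x) \<le> l * \<gamma>"
    using iii(2) unfolding property2_def by blast
  obtain fl where fl: "\<And>k. fl \<le> f1 (x23 k)" using iv by blast
  obtain r where r: "\<And>k. \<rho>1 (mu k) k \<le> r" using vi(2) by blast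
  obtain M where M: "\<And>k. \<exists>v\<in>subdifferential f0 (x k). norm v < M" using vii by blast

  define e where "e k = norm (x k - x13 k)" for k
  define \<delta> where "\<delta> k = M * e k + \<rho>0 (lam k) k / \<beta> + (mu k / lam k) * (F - fl + r / \<beta>)" for k
  have "(\<lambda>k. M * e k + \<rho>0 (lam k) k / \<beta> + (mu k / lam k) * (F - fl + r / \<beta>))
      \<longlonglongrightarrow> M * 0 + 0 / \<beta> + 0 * (F - fl + r / \<beta>)"
    unfolding e_def using v vi(1) ii(3) \<beta> by (intro tendsto_intros) auto
  then have \<delta>: "\<delta> \<longlonglongrightarrow> 0" by (simp add: \<delta>_def[abs_def])

  have nonexp: "norm (x (Suc k) - y) \<le> norm (x23 k - y)" if "y \<in> X0" for k y
    using closest_point_lipschitz[OF X0(3,2,1), of "x23 k" y] closest_point_self[OF that]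
    by (simp add: step3 dist_norm)

  have lyapunov: "(d (Suc k))\<^sup>2 \<le> (d k)\<^sup>2 - \<beta> * lam k * (f0 (x k) - m - \<delta> k)" for k
  proof -
    have 1: "(norm (x13 k - p k))\<^sup>2 \<le> (norm (x k - p k))\<^sup>2
        - \<beta> * lam k * (f0 (x13 k) - f0 (p k)) + lam k * \<rho>0 (lam k) k"
      using P1(1) stepsizes(1)[of k] less_imp_le unfolding property1_def step1 by blast
    have 2: "(norm (x23 k - p k))\<^sup>2 \<le> (norm (x13 k - p k))\<^sup>2
        - \<beta> * mu k * (f1 (x23 k) - f1 (p k)) + mu k * \<rho>1 (mu k) k"
      using P1(2) stepsizes(2)[of k] unfolding property1_def step2 by blast
    obtain v where v: "v \<in> subdifferential f0 (x k)" "norm v < M" using M by blast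
    have "\<bar>inner v (x13 k - x k)\<bar> \<le> norm v * e k"
      using Cauchy_Schwarz_ineq2[of v "x13 k - x k"] by (simp add: e_def norm_minus_commute)
    also have "\<dots> \<le> M * e k" using v(2) by (intro mult_right_mono) (auto simp: e_def)
    finally have sub: "f0 (x k) - M * e k \<le> f0 (x13 k)"
      using v(1) unfolding subdifferential_def by (smt (verit) mem_Collect_eq)
    have a: "\<beta> * lam k * (f0 (x k) - M * e k - m) \<le> \<beta> * lam k * (f0 (x13 k) - f0 (p k))"
      using sub pX0(2)[of k] \<beta> stepsizes(1)[of k] by (intro mult_left_mono) auto
    have b: "\<beta> * mu k * (fl - F) \<le> \<beta> * mu k * (f1 (x23 k) - f1 (p k))"
      using fl[of k] F[of k] \<beta> stepsizes(2)[of k] by (intro mult_left_mono) auto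
    have c: "mu k * \<rho>1 (mu k) k \<le> mu k * r"
      using r stepsizes(2) by (intro mult_left_mono) auto
    have "\<beta> * lam k * \<delta> k = \<beta> * lam k * (M * e k) + lam k * \<rho>0 (lam k) k
        + \<beta> * mu k * (F - fl) + mu k * r"
      using \<beta> stepsizes(1)[of k] by (simp add: \<delta>_def field_simps)
    with 1 2 a b c have "(norm (x23 k - p k))\<^sup>2
        \<le> (norm (x k - p k))\<^sup>2 - \<beta> * lam k * (f0 (x k) - m - \<delta> k)"
      by (simp add: algebra_simps)
    moreover have "d (Suc k) \<le> norm (x23 k - p k)"
      using infdist_le[OF p(1)[of k], of "x (Suc k)"] nonexp[OF pX0(1), of k k]
      by (simp add: d_def dist_norm)
    then have "(d (Suc k))\<^sup>2 \<le> (norm (x23 k - p k))\<^sup>2"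
      by (intro power_mono) (auto simp: d_def infdist_nonneg)
    ultimately show ?thesis using p(2)[of k] by (simp add: dist_norm)
  qed

  have "d \<longlonglongrightarrow> 0"
  proof (rule tendsto_0_if_decrease_away_from_0[OF _ _ ii(1)])
    show "0 \<le> d k" for k by (simp add: d_def infdist_nonneg)
    show "0 \<le> lam k" for k using stepsizes(1)[of k] by simp
    have "(\<lambda>k. e k + mu k * \<gamma>) \<longlonglongrightarrow> 0 + 0 * \<gamma>"
      unfolding e_def using v ii(2) by (intro tendsto_intros)
    then show "(\<lambda>k. e k + mu k * \<gamma>) \<longlonglongrightarrow> 0" by simp
    have "d (Suc k) \<le> d k + (e k + mu k * \<gamma>)" if "k \<ge> 1" for k
    proof -
      \<comment> \<open>The projection fixes \<open>x k\<close> only from \<open>k = 1\<close> on: the starting point may lie outside \<open>X0\<close>.\<close>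
      have "x k \<in> X0" using xX0[of "k - 1"] that by simp
      then have "norm (x (Suc k) - x k) \<le> norm (x23 k - x k)" by (rule nonexp)
      also have "\<dots> \<le> e k + norm (x13 k - x23 k)"
        using norm_triangle_ineq[of "x k - x13 k" "x13 k - x23 k"]
        by (simp add: e_def norm_minus_commute)
      also have "\<dots> \<le> e k + mu k * \<gamma>"
        using \<gamma>[OF stepsizes(2)[of k], of "x13 k"] by (simp add: step2)
      finally show ?thesis
        using infdist_triangle[of "x (Suc k)" X1 "x k"] by (simp add: d_def dist_norm)
    qed
    then show "eventually (\<lambda>k. d (Suc k) \<le> d k + (e k + mu k * \<gamma>)) sequentially"
      unfolding eventually_sequentially by blast
  next
    fix \<eta> :: real assume "\<eta> > 0"
    have "convex_on X0 f0" "continuous_on X0 f0"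
      using convex_f(1) cont(1) X0(3) by (auto intro: convex_on_subset continuous_on_subset)
    from convex_sublevel_gap[OF this X0(2,3) X1_sub \<open>\<eta> > 0\<close>, of B]
    obtain c where c: "c > 0" and gap0: "\<forall>y\<in>X0. \<forall>q\<in>X1. norm q \<le> B \<longrightarrow> dist y q = infdist y X1
        \<longrightarrow> \<eta> \<le> infdist y X1 \<longrightarrow> m + c \<le> f0 y" by blast
    have gap: "m + c \<le> f0 (x k)" if "x k \<in> X0" "\<eta> \<le> d k" for k
      using gap0 that p[of k] B[of k] unfolding d_def by blast
    have "eventually (\<lambda>k. \<delta> k < c / 2) sequentially"
      using order_tendstoD(2)[OF \<delta>, of "c / 2"] c by simp
    then have "eventually (\<lambda>k. \<eta> \<le> d k \<longrightarrow> (d (Suc k))\<^sup>2 \<le> (d k)\<^sup>2 - (\<beta> * c / 2) * lam k) sequentially"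
      using eventually_ge_at_top[of 1]
    proof eventually_elim
      case (elim k)
      show ?case
      proof
        assume "\<eta> \<le> d k"
        moreover have "x k \<in> X0" using xX0[of "k - 1"] elim by simp
        ultimately have "c / 2 \<le> f0 (x k) - m - \<delta> k" using gap[of k] elim by simp
        then have "\<beta> * lam k * (c / 2) \<le> \<beta> * lam k * (f0 (x k) - m - \<delta> k)"
          using \<beta> stepsizes(1)[of k] by (intro mult_left_mono) auto
        then show "(d (Suc k))\<^sup>2 \<le> (d k)\<^sup>2 - (\<beta> * c / 2) * lam k"
          using lyapunov[of k] by (simp add: algebra_simps)
      qed
    qed
    then show "\<exists>c>0. eventually (\<lambda>k. \<eta> \<le> d k \<longrightarrow> (d (Suc k))\<^sup>2 \<le> (d k)\<^sup>2 - c * lam k) sequentially"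
      using \<beta> c by (intro exI[of _ "\<beta> * c / 2"]) simp
  qed
  then show ?thesis by (simp add: d_def[abs_def] proj_dist_eq_infdist[OF cl])
qed

end
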